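(* Let $g:\mathbb{R}^n\to\mathbb{R}$ be a proper, closed, and convex (not necessarily differentiable) function, and let $f:\mathbb{R}^n\to\mathbb{R}$ be convex and twice continuously differentiable with $\nabla^2 f(x)\preceq L_f I$ for all $x\in\mathbb{R}^n$. Let $\mu\in(0,1/L_f)$ and $\gamma>0$ be such that the proximal Polyak-Lojasiewicz condition $$\|G_\mu(x)\|_2^2\;\ge\;\gamma\,\bigl(F_\mu(x)-F_\mu^\star\bigr)\qquad\text{for all }x\in\mathbb{R}^n$$ holds, where $G_\mu$ is the generalized gradient map, $F_\mu$ is the forward-backward envelope, and $F_\mu^\star$ is the optimal value of $F_\mu$. Then, along the solutions $x(t)$ of the proximal gradient flow dynamics $$\dot x\;=\;-\bigl(x-\mathrm{prox}_{\mu g}(x-\mu\nabla f(x))\bigr)\;=\;-\mu\,G_\mu(x),$$ the forward-backward envelope converges exponentially to $F_\mu^\star=F^\star$, where $F^\star$ is the optimal value of $F:=f+g$, with the rate $\rho=\gamma\mu(1-\mu L_f)$, i.e., $$F_\mu(x(t))-F_\mu^\star\;\le\;\mathrm{e}^{-\rho t}\,\bigl(F_\mu(x(0))-F_\mu^\star\bigr),\qquad\forall\, t\ge 0.$$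
   Context: For a proper, closed, convex function $g$ on $\mathbb{R}^n$ and $\mu>0$, the proximal operator is the single-valued map $$\mathrm{prox}_{\mu g}(v):=\operatorname*{argmin}_{z}\Bigl(g(z)+\tfrac{1}{2\mu}\|z-v\|_2^2\Bigr),$$ and the Moreau envelope is $$M_{\mu g}(v):=g(\mathrm{prox}_{\mu g}(v))+\tfrac{1}{2\mu}\|\mathrm{prox}_{\mu g}(v)-v\|_2^2 .$$ The forward-backward envelope is $$F_\mu(x):=f(x)+M_{\mu g}\bigl(x-\mu\nabla f(x)\bigr)-\tfrac{\mu}{2}\|\nabla f(x)\|_2^2,$$ and the generalized gradient map is $$G_\mu(x):=\tfrac{1}{\mu}\bigl(x-\mathrm{prox}_{\mu g}(x-\mu\nabla f(x))\bigr).$$ $F_\mu^\star$ and $F^\star$ denote the optimal (minimal) values over $\mathbb{R}^n$ of $F_\mu$ and $F=f+g$, respectively. *)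

theory Defs
  imports "HOL-Analysis.Analysis"
begin

text \<open>
  Proper closed convex functions take values in the extended reals, so that indicator functions of
  closed convex sets are covered; finite-valued functions are the special case
  \<open>\<lambda>x. ereal (h x)\<close>.  Closedness and convexity are those of the epigraph, a subset of
  \<open>\<real>\<^sup>n \<times> \<real>\<close>.
\<close>

definition ereal_epigraph :: "('a \<Rightarrow> ereal) \<Rightarrow> ('a \<times> real) set" where
  "ereal_epigraph g = {(x, r). g x \<le> ereal r}"

definition proper_fun :: "('a \<Rightarrow> ereal) \<Rightarrow> bool" where
  "proper_fun g \<longleftrightarrow> (\<forall>x. g x \<noteq> -\<infinity>) \<and> (\<exists>x. g x \<noteq> \<infinity>)"

definition closed_fun :: "('a::topological_space \<Rightarrow> ereal) \<Rightarrow> bool" where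
  "closed_fun g \<longleftrightarrow> closed (ereal_epigraph g)"

definition convex_fun :: "('a::real_vector \<Rightarrow> ereal) \<Rightarrow> bool" where
  "convex_fun g \<longleftrightarrow> convex (ereal_epigraph g)"

lemma proper_closed_convex_finite_valued:
  fixes h :: "'a::euclidean_space \<Rightarrow> real"
  assumes "convex_on UNIV h"
  shows "proper_fun (\<lambda>x. ereal (h x))" "closed_fun (\<lambda>x. ereal (h x))"
    "convex_fun (\<lambda>x. ereal (h x))"
proof -
  have epi: "ereal_epigraph (\<lambda>x. ereal (h x)) = epigraph UNIV h"
    by (auto simp: ereal_epigraph_def epigraph_def)
  have cont: "continuous_on UNIV h"
    using assms by (simp add: convex_on_continuous)
  have "continuous_on UNIV (\<lambda>p::'a \<times> real. h (fst p))"
    by (rule continuous_on_compose2[OF cont]) (auto intro: continuous_intros)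
  then have "closed {p::'a \<times> real. h (fst p) \<le> snd p}"
    by (intro closed_Collect_le continuous_intros)
  then show "closed_fun (\<lambda>x. ereal (h x))"
    by (simp add: closed_fun_def epi epigraph_def)
  show "convex_fun (\<lambda>x. ereal (h x))"
    using assms by (simp add: convex_fun_def epi convex_epigraph)
  show "proper_fun (\<lambda>x. ereal (h x))"
    by (simp add: proper_fun_def)
qed

definition grad :: "('a::real_inner \<Rightarrow> real) \<Rightarrow> 'a \<Rightarrow> 'a" where
  "grad f x = (THE D. GDERIV f x :> D)"

definition hessian :: "(real ^ 'n \<Rightarrow> real) \<Rightarrow> real ^ 'n \<Rightarrow> real ^ 'n ^ 'n" where
  "hessian f x = matrix (frechet_derivative (grad f) (at x))"

definition twice_continuously_differentiable :: "(real ^ 'n \<Rightarrow> real) \<Rightarrow> bool" where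
  "twice_continuously_differentiable f \<longleftrightarrow>
     (\<forall>x. f differentiable at x) \<and> (\<forall>x. grad f differentiable at x) \<and>
     continuous_on UNIV (hessian f)"

text \<open>
  The Loewner order, intended for symmetric matrices (the Hessian of a \<open>C\<^sup>2\<close> function is
  automatically symmetric).
\<close>

definition loewner_le :: "real ^ 'n ^ 'n \<Rightarrow> real ^ 'n ^ 'n \<Rightarrow> bool" where
  "loewner_le A B \<longleftrightarrow> (\<forall>v. 0 \<le> v \<bullet> ((B - A) *v v))"

text \<open>
  In the following, \<open>\<mu>\<close> and \<open>g\<close> are separate arguments: \<open>prox \<mu> g\<close> is the
  proximal operator of \<open>\<mu>g\<close>.  The minimiser exists and is unique for proper closed convex
  \<open>g\<close> and \<open>\<mu> > 0\<close>.
\<close>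

definition prox :: "real \<Rightarrow> ('a::real_normed_vector \<Rightarrow> ereal) \<Rightarrow> 'a \<Rightarrow> 'a" where
  "prox \<mu> g v = arg_min (\<lambda>z. g z + ereal (1 / (2 * \<mu>) * (norm (z - v))\<^sup>2)) (\<lambda>_. True)"

definition moreau_envelope :: "real \<Rightarrow> ('a::real_normed_vector \<Rightarrow> ereal) \<Rightarrow> 'a \<Rightarrow> ereal" where
  "moreau_envelope \<mu> g v = g (prox \<mu> g v) + ereal (1 / (2 * \<mu>) * (norm (prox \<mu> g v - v))\<^sup>2)"

definition fb_envelope ::
  "real \<Rightarrow> ('a::real_inner \<Rightarrow> real) \<Rightarrow> ('a \<Rightarrow> ereal) \<Rightarrow> 'a \<Rightarrow> ereal" where
  "fb_envelope \<mu> f g x =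
     ereal (f x) + moreau_envelope \<mu> g (x - \<mu> *\<^sub>R grad f x) - ereal (\<mu> / 2 * (norm (grad f x))\<^sup>2)"

definition gen_grad_map ::
  "real \<Rightarrow> ('a::real_inner \<Rightarrow> real) \<Rightarrow> ('a \<Rightarrow> ereal) \<Rightarrow> 'a \<Rightarrow> 'a" where
  "gen_grad_map \<mu> f g x = (1 / \<mu>) *\<^sub>R (x - prox \<mu> g (x - \<mu> *\<^sub>R grad f x))"

text \<open>
  Optimal values are extended-real infima, so no boundedness is presupposed: the value is
  \<open>-\<infinity>\<close> for a function that is unbounded below.
\<close>

definition optimal_value :: "('a \<Rightarrow> ereal) \<Rightarrow> ereal" where
  "optimal_value F = (INF x. F x)"

definition proximal_PL ::
  "real \<Rightarrow> real \<Rightarrow> ('a::real_inner \<Rightarrow> real) \<Rightarrow> ('a \<Rightarrow> ereal) \<Rightarrow> bool" where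
  "proximal_PL \<gamma> \<mu> f g \<longleftrightarrow>
     (\<forall>x. ereal ((norm (gen_grad_map \<mu> f g x))\<^sup>2) \<ge>
        ereal \<gamma> * (fb_envelope \<mu> f g x - optimal_value (fb_envelope \<mu> f g)))"

definition prox_grad_flow_solution ::
  "real \<Rightarrow> ('a::real_inner \<Rightarrow> real) \<Rightarrow> ('a \<Rightarrow> ereal) \<Rightarrow> (real \<Rightarrow> 'a) \<Rightarrow> bool" where
  "prox_grad_flow_solution \<mu> f g x \<longleftrightarrow>
     (\<forall>t\<ge>0. (x has_vector_derivative - (x t - prox \<mu> g (x t - \<mu> *\<^sub>R grad f (x t))))
        (at t within {0..}))"

end

theory Submission
  imports Defs
begin

text \<open>
  Writing \<open>H\<close> for the Hessian of \<open>f\<close> and \<open>G\<close> for the generalized gradient map, the Moreau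
  envelope has gradient \<open>(v - prox v) / \<mu>\<close>, so the envelope \<open>F\<close> is differentiable with gradient
  \<open>(I - \<mu> H) G\<close>.  Along the flow \<open>x' = - \<mu> G\<close> its derivative is
  \<open>- \<mu> G \<bullet> (I - \<mu> H) G \<le> - \<mu> (1 - \<mu> L) \<parallel>G\<parallel>\<^sup>2\<close>, and the proximal PL condition turns this into
  a linear differential inequality for \<open>F - F\<^sup>\<star>\<close>.  The optimal values agree because
  \<open>(f + g) (p x) \<le> F x \<le> (f + g) x\<close>, where \<open>p x\<close> is the proximal point of \<open>x - \<mu> \<nabla>f x\<close>; the
  first inequality is the descent lemma.
\<close>

section \<open>Existence and optimality of the proximal point\<close>

text \<open>A point just below the graph is strictly separated from the closed convex epigraph; the
  separating hyperplane is the graph of the minorant. The minorant makes the proximal objective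
  coercive.\<close>

lemma affine_minorant:
  fixes g :: "'a::euclidean_space \<Rightarrow> ereal"
  assumes "proper_fun g" "closed_fun g" "convex_fun g"
  obtains a b where "\<And>x. ereal (a \<bullet> x + b) \<le> g x"
proof -
  obtain x0 where "\<bar>g x0\<bar> \<noteq> \<infinity>"
    using assms(1) by (auto simp: proper_fun_def)
  then obtain c where c: "g x0 = ereal c" by auto
  have "(x0, c - 1) \<notin> ereal_epigraph g" by (simp add: ereal_epigraph_def c)
  then obtain p \<beta> where p: "p \<bullet> (x0, c - 1) < \<beta>" "\<And>z. z \<in> ereal_epigraph g \<Longrightarrow> \<beta> < p \<bullet> z"
    using separating_hyperplane_closed_point[of "ereal_epigraph g" "(x0, c - 1)"] assms(2,3)
    unfolding closed_fun_def convex_fun_def by blast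
  obtain q s where q: "p = (q, s)" by (cases p)
  \<comment> \<open>The hyperplane passes strictly between \<open>(x0, c - 1)\<close> and
    \<open>(x0, c)\<close>, so it is not vertical and can be solved for the last coordinate.\<close>
  have "s * (c - 1) < s * c"
    using p(1) p(2)[of "(x0, c)"] by (auto simp: q ereal_epigraph_def c)
  then have s: "s > 0" by (simp add: algebra_simps)
  have "ereal ((- (1 / s) *\<^sub>R q) \<bullet> x + \<beta> / s) \<le> g x" for x
  proof (cases "g x")
    case (real r)
    then have "\<beta> < q \<bullet> x + s * r"
      using p(2)[of "(x, r)"] by (auto simp: q ereal_epigraph_def)
    then show ?thesis using s real by (simp add: field_simps)
  qed (use assms(1) in \<open>auto simp: proper_fun_def\<close>)
  then show ?thesis by (rule that)
qed

text \<open>For \<open>s > 1\<close> the constant \<open>\<bar>d\<bar>\<close> is at most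
  \<open>\<bar>d\<bar> * s\<close>, so a factor \<open>s\<close> can be cancelled and a linear bound
  remains.\<close>

lemma quadratic_sublevel_bounded:
  fixes k n d s :: real
  assumes "0 < k" "0 \<le> n" "k * s\<^sup>2 - n * s \<le> d"
  shows "s \<le> 1 + (\<bar>d\<bar> + n) / k"
proof (cases "s \<le> 1")
  case True
  then show ?thesis using assms by (simp add: add_increasing2)
next
  case False
  have "k * s * s \<le> n * s + \<bar>d\<bar>" using assms by (simp add: power2_eq_square)
  also have "\<dots> \<le> (n + \<bar>d\<bar>) * s"
    using False mult_left_mono[of 1 s "\<bar>d\<bar>"] by (simp add: algebra_simps)
  finally have "k * s \<le> n + \<bar>d\<bar>" using False by simp
  then have "s \<le> (\<bar>d\<bar> + n) / k" using assms(1) by (simp add: field_simps)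
  then show ?thesis by simp
qed

text \<open>The objective is only lower semicontinuous, so the continuous function \<open>h\<close>
  is minimised over the epigraph instead. Its sublevel set \<open>S\<close> is closed, and bounded
  by the affine minorant, hence compact.\<close>

lemma prox_objective_has_minimizer:
  fixes g :: "'a::euclidean_space \<Rightarrow> ereal"
  assumes g: "proper_fun g" "closed_fun g" "convex_fun g" and k: "0 < (k::real)"
  obtains p where "\<And>z. g p + ereal (k * (norm (p - v))\<^sup>2) \<le> g z + ereal (k * (norm (z - v))\<^sup>2)"
proof -
  define h where "h = (\<lambda>y::'a \<times> real. snd y + k * (norm (fst y - v))\<^sup>2)"
  obtain a b where ab: "\<And>x. ereal (a \<bullet> x + b) \<le> g x"
    using affine_minorant[OF g] by blast
  obtain x0 where "\<bar>g x0\<bar> \<noteq> \<infinity>"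
    using g(1) by (auto simp: proper_fun_def)
  then obtain c where c: "g x0 = ereal c" by auto
  define S where "S = {y \<in> ereal_epigraph g. h y \<le> h (x0, c)}"
  have cont: "continuous_on UNIV h" unfolding h_def by (intro continuous_intros)
  have "closed S"
  proof -
    have "S = ereal_epigraph g \<inter> {y. h y \<le> h (x0, c)}" by (auto simp: S_def)
    moreover have "closed {y. h y \<le> h (x0, c)}"
      by (intro closed_Collect_le cont continuous_on_const)
    ultimately show ?thesis using g(2) by (auto simp: closed_fun_def)
  qed
  moreover have "bounded S"
  proof -
    \<comment> \<open>On \<open>S\<close> the minorant and Cauchy-Schwarz give
      \<open>k * s^2 - norm a * s \<le> h (x0, c) - a \<bullet> v - b\<close> for
      \<open>s = norm (z - v)\<close>; \<open>R\<close> is the resulting bound on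
      \<open>s\<close>.\<close>
    define R where "R = 1 + (\<bar>h (x0, c) - a \<bullet> v - b\<bar> + norm a) / k"
    have "z \<in> cball v R \<and> r \<in> {a \<bullet> v + b - norm a * R .. h (x0, c)}" if "(z, r) \<in> S" for z r
    proof -
      have "ereal (a \<bullet> z + b) \<le> ereal r"
        using that ab[of z] unfolding S_def ereal_epigraph_def by (auto dest: order_trans)
      then have r: "a \<bullet> z + b \<le> r" by simp
      have le: "r + k * (norm (z - v))\<^sup>2 \<le> h (x0, c)"
        using that by (simp add: S_def h_def)
      have cs: "- (norm a * norm (z - v)) \<le> a \<bullet> z - a \<bullet> v"
        using Cauchy_Schwarz_ineq2[of a "z - v"] by (simp add: inner_diff_right abs_le_iff)
      then have "norm (z - v) \<le> R"
        unfolding R_def using k r le by (intro quadratic_sublevel_bounded) auto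
      moreover from this have "norm a * norm (z - v) \<le> norm a * R"
        by (simp add: mult_left_mono)
      moreover have "r \<le> h (x0, c)"
        using le k by (smt (verit) mult_nonneg_nonneg zero_le_power2)
      ultimately show ?thesis using r cs by (auto simp: dist_norm norm_minus_commute)
    qed
    then have "S \<subseteq> cball v R \<times> {a \<bullet> v + b - norm a * R .. h (x0, c)}" by auto
    then show ?thesis
      by (rule bounded_subset[rotated]) (intro bounded_Times bounded_cball bounded_closed_interval)
  qed
  ultimately have "compact S" by (simp add: compact_eq_bounded_closed)
  moreover have "(x0, c) \<in> S" by (simp add: S_def ereal_epigraph_def c)
  ultimately obtain y where y: "y \<in> S" "\<And>w. w \<in> S \<Longrightarrow> h y \<le> h w"
    using continuous_attains_inf[of S h] continuous_on_subset[OF cont] by blast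
  have hy: "h y \<le> h w" if "w \<in> ereal_epigraph g" for w
    using y that by (cases "h w \<le> h (x0, c)") (auto simp: S_def)
  have "g (fst y) + ereal (k * (norm (fst y - v))\<^sup>2) \<le> g z + ereal (k * (norm (z - v))\<^sup>2)" for z
  proof (cases "g z")
    case (real r)
    \<comment> \<open>Passing from \<open>y\<close> down to the graph can only decrease the
      objective, so \<open>fst y\<close> minimises it.\<close>
    have "g (fst y) \<le> ereal (snd y)"
      using y(1) by (auto simp: S_def ereal_epigraph_def)
    then have "g (fst y) + ereal (k * (norm (fst y - v))\<^sup>2) \<le> ereal (h y)"
      unfolding h_def plus_ereal.simps(1)[symmetric] by (rule add_right_mono)
    also have "\<dots> \<le> ereal (h (z, r))"
      using hy[of "(z, r)"] real by (simp add: ereal_epigraph_def)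
    finally show ?thesis by (simp add: h_def real)
  qed (use g(1) in \<open>auto simp: proper_fun_def\<close>)
  then show ?thesis by (rule that)
qed

text \<open>\<open>prox\<close> is a choice among minimisers, so the existence of one guarantees
  that the chosen point is a minimiser.\<close>

lemma moreau_envelope_le:
  fixes g :: "'a::euclidean_space \<Rightarrow> ereal"
  assumes g: "proper_fun g" "closed_fun g" "convex_fun g" and \<mu>: "0 < \<mu>"
  shows "moreau_envelope \<mu> g v \<le> g z + ereal (1 / (2 * \<mu>) * (norm (z - v))\<^sup>2)"
proof -
  let ?\<phi> = "\<lambda>z. g z + ereal (1 / (2 * \<mu>) * (norm (z - v))\<^sup>2)"
  obtain p where "\<And>z. ?\<phi> p \<le> ?\<phi> z"
    using prox_objective_has_minimizer[OF g, of "1 / (2 * \<mu>)" v] \<mu> by auto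
  then have "is_arg_min ?\<phi> (\<lambda>_. True) p" by (simp add: is_arg_min_def not_less)
  then have "is_arg_min ?\<phi> (\<lambda>_. True) (prox \<mu> g v)"
    unfolding prox_def arg_min_def by (rule someI)
  then show ?thesis by (simp add: is_arg_min_def not_less moreau_envelope_def)
qed

lemma prox_in_domain:
  fixes g :: "'a::euclidean_space \<Rightarrow> ereal"
  assumes g: "proper_fun g" "closed_fun g" "convex_fun g" and \<mu>: "0 < \<mu>"
  obtains r where "g (prox \<mu> g v) = ereal r"
proof -
  obtain x0 where x0: "g x0 \<noteq> \<infinity>" using g(1) by (auto simp: proper_fun_def)
  have "g (prox \<mu> g v) \<noteq> \<infinity>"
    using moreau_envelope_le[OF assms, of v x0] x0 by (auto simp: moreau_envelope_def)
  moreover have "g (prox \<mu> g v) \<noteq> -\<infinity>" using g(1) by (simp add: proper_fun_def)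
  ultimately show ?thesis using that by (cases "g (prox \<mu> g v)") auto
qed

lemma convex_fun_ereal_le:
  assumes "convex_fun g" "g x = ereal r" "g y = ereal s" "0 \<le> t" "t \<le> 1"
  shows "g ((1 - t) *\<^sub>R x + t *\<^sub>R y) \<le> ereal ((1 - t) * r + t * s)"
proof -
  have "(1 - t) *\<^sub>R (x, r) + t *\<^sub>R (y, s) \<in> ereal_epigraph g"
    using assms by (intro convexD) (auto simp: convex_fun_def ereal_epigraph_def)
  then show ?thesis by (simp add: ereal_epigraph_def)
qed

text \<open>This says that \<open>(v - p) / \<mu>\<close> is a subgradient of \<open>g\<close> at
  the proximal point \<open>p\<close>. Minimality is tested at points of the segment from
  \<open>p\<close> to \<open>z\<close>, where convexity bounds \<open>g\<close>; dividing by
  \<open>t\<close> and letting \<open>t\<close> tend to 0 removes the quadratic term.\<close>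

lemma prox_subgradient:
  fixes g :: "'a::euclidean_space \<Rightarrow> ereal"
  assumes g: "proper_fun g" "closed_fun g" "convex_fun g" and \<mu>: "0 < \<mu>"
    and r: "g (prox \<mu> g v) = ereal r" and s: "g z = ereal s"
  shows "(v - prox \<mu> g v) \<bullet> (z - prox \<mu> g v) \<le> \<mu> * (s - r)"
proof -
  define p where "p = prox \<mu> g v"
  have step: "(v - p) \<bullet> (z - p) \<le> \<mu> * (s - r) + t * ((norm (z - p))\<^sup>2 / 2)" if t: "0 < t" "t \<le> 1" for t
  proof -
    define w where "w = (1 - t) *\<^sub>R p + t *\<^sub>R z"
    have "ereal (r + 1 / (2 * \<mu>) * (norm (p - v))\<^sup>2) \<le> g w + ereal (1 / (2 * \<mu>) * (norm (w - v))\<^sup>2)"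
      using moreau_envelope_le[OF g \<mu>, of v w] r by (simp add: moreau_envelope_def p_def)
    also have "\<dots> \<le> ereal ((1 - t) * r + t * s) + ereal (1 / (2 * \<mu>) * (norm (w - v))\<^sup>2)"
      unfolding w_def using t r s g(3)
      by (intro add_right_mono convex_fun_ereal_le) (auto simp: p_def)
    finally have "t * (r - s) \<le> 1 / (2 * \<mu>) * ((norm (w - v))\<^sup>2 - (norm (p - v))\<^sup>2)"
      by (simp add: algebra_simps)
    moreover have w: "w - v = (p - v) + t *\<^sub>R (z - p)" by (simp add: w_def algebra_simps)
    have "(norm (w - v))\<^sup>2 - (norm (p - v))\<^sup>2
        = t * (t * (norm (z - p))\<^sup>2 - 2 * ((v - p) \<bullet> (z - p)))"
      unfolding w by (simp add: power2_norm_eq_inner algebra_simps inner_commute)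
    ultimately have "t * (r - s) \<le> t * (1 / (2 * \<mu>) * (t * (norm (z - p))\<^sup>2 - 2 * ((v - p) \<bullet> (z - p))))"
      by (simp only: mult.left_commute)
    then have "r - s \<le> 1 / (2 * \<mu>) * (t * (norm (z - p))\<^sup>2 - 2 * ((v - p) \<bullet> (z - p)))"
      using t(1) by (simp only: mult_le_cancel_left_pos)
    then show ?thesis using \<mu> by (simp add: field_simps)
  qed
  have "((\<lambda>t. \<mu> * (s - r) + t * ((norm (z - p))\<^sup>2 / 2)) \<longlongrightarrow> \<mu> * (s - r) + 0 * ((norm (z - p))\<^sup>2 / 2))
      (at_right 0)"
    by (intro tendsto_intros)
  moreover have "eventually (\<lambda>t. (v - p) \<bullet> (z - p) \<le> \<mu> * (s - r) + t * ((norm (z - p))\<^sup>2 / 2)) (at_right (0::real))"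
    unfolding eventually_at_right_field using step by (intro exI[of _ 1]) auto
  ultimately have "(v - p) \<bullet> (z - p) \<le> \<mu> * (s - r) + 0 * ((norm (z - p))\<^sup>2 / 2)"
    by (rule tendsto_lowerbound) simp
  then show ?thesis by (simp add: p_def)
qed

text \<open>Each proximal point is tested in the subgradient inequality of the other. In the sum the
  values of \<open>g\<close> cancel, which leaves firm nonexpansiveness; Cauchy-Schwarz
  finishes.\<close>

lemma prox_nonexpansive:
  fixes g :: "'a::euclidean_space \<Rightarrow> ereal"
  assumes g: "proper_fun g" "closed_fun g" "convex_fun g" and \<mu>: "0 < \<mu>"
  shows "norm (prox \<mu> g w - prox \<mu> g v) \<le> norm (w - v)"
proof -
  define p q where "p = prox \<mu> g v" and "q = prox \<mu> g w"
  obtain r s where r: "g p = ereal r" and s: "g q = ereal s"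
    using prox_in_domain[OF assms] p_def q_def by metis
  have "(v - p) \<bullet> (q - p) \<le> \<mu> * (s - r)" "(w - q) \<bullet> (p - q) \<le> \<mu> * (r - s)"
    using prox_subgradient[OF assms, of v r q s] prox_subgradient[OF assms, of w s p r] r s
    by (simp_all add: p_def q_def)
  then have "(v - p) \<bullet> (q - p) + (w - q) \<bullet> (p - q) \<le> 0" by (simp add: algebra_simps)
  then have "(norm (q - p))\<^sup>2 \<le> (w - v) \<bullet> (q - p)"
    by (simp add: power2_norm_eq_inner algebra_simps inner_commute)
  also have "\<dots> \<le> norm (w - v) * norm (q - p)" by (rule norm_cauchy_schwarz)
  finally show ?thesis
    by (cases "q = p") (simp_all add: power2_eq_square p_def q_def)
qed

section \<open>Differentiability of the Moreau envelope\<close>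

lemma moreau_envelope_real:
  fixes g :: "'a::euclidean_space \<Rightarrow> ereal"
  assumes "proper_fun g" "closed_fun g" "convex_fun g" "0 < \<mu>"
  shows "ereal (real_of_ereal (moreau_envelope \<mu> g v)) = moreau_envelope \<mu> g v"
proof -
  obtain r where "g (prox \<mu> g v) = ereal r" using prox_in_domain[OF assms] .
  then show ?thesis by (simp add: moreau_envelope_def)
qed

text \<open>Testing the problem defining the envelope at \<open>w\<close> with the minimiser for \<open>v\<close>.\<close>

lemma moreau_envelope_diff_le:
  fixes g :: "'a::euclidean_space \<Rightarrow> ereal"
  assumes "proper_fun g" "closed_fun g" "convex_fun g" and \<mu>: "0 < \<mu>"
  shows "real_of_ereal (moreau_envelope \<mu> g w) - real_of_ereal (moreau_envelope \<mu> g v)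
    \<le> (w - v) \<bullet> ((1 / \<mu>) *\<^sub>R (v - prox \<mu> g v)) + 1 / (2 * \<mu>) * (norm (w - v))\<^sup>2"
proof -
  define p where "p = prox \<mu> g v"
  obtain r where r: "g p = ereal r" using prox_in_domain[OF assms] p_def by metis
  have "ereal (real_of_ereal (moreau_envelope \<mu> g w)) \<le> g p + ereal (1 / (2 * \<mu>) * (norm (p - w))\<^sup>2)"
    unfolding moreau_envelope_real[OF assms] by (rule moreau_envelope_le[OF assms])
  moreover have "real_of_ereal (moreau_envelope \<mu> g v) = r + 1 / (2 * \<mu>) * (norm (p - v))\<^sup>2"
    using r by (simp add: moreau_envelope_def p_def)
  ultimately have "real_of_ereal (moreau_envelope \<mu> g w) - real_of_ereal (moreau_envelope \<mu> g v)
      \<le> 1 / (2 * \<mu>) * ((norm (p - w))\<^sup>2 - (norm (p - v))\<^sup>2)"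
    using r by (simp add: algebra_simps)
  also have "(norm (p - w))\<^sup>2 - (norm (p - v))\<^sup>2 = 2 * ((w - v) \<bullet> (v - p)) + (norm (w - v))\<^sup>2"
    by (simp add: power2_norm_eq_inner algebra_simps inner_commute)
  finally show ?thesis using \<mu> by (simp add: p_def algebra_simps)
qed

lemma has_derivative_quadratic_remainder:
  fixes \<phi> :: "'a::real_normed_vector \<Rightarrow> 'b::real_normed_vector"
  assumes "bounded_linear D" and le: "\<And>w. norm (\<phi> w - \<phi> v - D (w - v)) \<le> C * (norm (w - v))\<^sup>2"
  shows "(\<phi> has_derivative D) (at v)"
proof (rule has_derivativeI_sandwich[of 1 _ _ _ _ "\<lambda>w. C * norm (w - v)"])
  show "norm (\<phi> w - \<phi> v - D (w - v)) / norm (w - v) \<le> C * norm (w - v)" if "w \<noteq> v" for w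
    using le[of w] that by (simp add: field_simps power2_eq_square)
  have "((\<lambda>w. C * norm (w - v)) \<longlongrightarrow> C * norm (v - v)) (at v)"
    by (intro tendsto_intros)
  then show "((\<lambda>w. C * norm (w - v)) \<longlongrightarrow> 0) (at v)" by simp
qed (use assms(1) in auto)

lemma moreau_envelope_gderiv:
  fixes g :: "'a::euclidean_space \<Rightarrow> ereal"
  assumes g: "proper_fun g" "closed_fun g" "convex_fun g" and \<mu>: "0 < \<mu>"
  shows "GDERIV (\<lambda>v. real_of_ereal (moreau_envelope \<mu> g v)) v :> (1 / \<mu>) *\<^sub>R (v - prox \<mu> g v)"
  unfolding gderiv_def
proof (rule has_derivative_quadratic_remainder)
  show "bounded_linear (\<lambda>h. h \<bullet> (1 / \<mu>) *\<^sub>R (v - prox \<mu> g v))" by (rule bounded_linear_inner_left)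
  fix w
  let ?M = "\<lambda>v. real_of_ereal (moreau_envelope \<mu> g v)"
  let ?G = "\<lambda>v. (1 / \<mu>) *\<^sub>R (v - prox \<mu> g v)"
  let ?N = "(norm (w - v))\<^sup>2"
  have up: "?M w - ?M v - (w - v) \<bullet> ?G v \<le> 1 / (2 * \<mu>) * ?N"
    using moreau_envelope_diff_le[OF assms, of w v] by simp
  \<comment> \<open>Swapping \<open>v\<close> and \<open>w\<close> yields a lower bound, but with
    the candidate gradient taken at \<open>w\<close>.\<close>
  have lo: "- (1 / (2 * \<mu>) * ?N) \<le> ?M w - ?M v - (w - v) \<bullet> ?G w"
    using moreau_envelope_diff_le[OF assms, of v w]
    by (simp add: norm_minus_commute inner_diff_left algebra_simps)
  have "(prox \<mu> g w - prox \<mu> g v) \<bullet> (w - v) \<le> norm (prox \<mu> g w - prox \<mu> g v) * norm (w - v)"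
    by (rule norm_cauchy_schwarz)
  also have "\<dots> \<le> norm (w - v) * norm (w - v)"
    by (intro mult_right_mono prox_nonexpansive[OF assms]) simp
  also have "\<dots> = (w - v) \<bullet> (w - v)" by (simp add: norm_eq_sqrt_inner)
  \<comment> \<open>Nonexpansiveness makes \<open>v - prox \<mu> g v\<close> monotone in
    \<open>v\<close>, so the gradient at \<open>w\<close> in the lower bound may be replaced by the
    one at \<open>v\<close>.\<close>
  finally have "0 \<le> (1 / \<mu>) * ((w - v) \<bullet> ((w - prox \<mu> g w) - (v - prox \<mu> g v)))"
    using \<mu> by (simp add: inner_diff_left inner_diff_right inner_commute)
  then have "(w - v) \<bullet> ?G v \<le> (w - v) \<bullet> ?G w" by (simp add: inner_diff_right algebra_simps)
  then show "norm (?M w - ?M v - (w - v) \<bullet> ?G v) \<le> 1 / (2 * \<mu>) * ?N"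
    using up lo by (simp add: abs_le_iff)
qed

section \<open>The forward-backward envelope\<close>

lemma GDERIV_unique:
  assumes "GDERIV f x :> D" "GDERIV f x :> E"
  shows "D = E"
proof -
  have "(\<lambda>h. h \<bullet> D) = (\<lambda>h. h \<bullet> E)"
    using assms unfolding gderiv_def by (rule has_derivative_unique)
  then show ?thesis by (metis vector_eq_ldot)
qed

text \<open>The adjoint of the derivative, applied to 1, is its Riesz representative; uniqueness
  then makes the definite description in \<open>grad\<close> denote it.\<close>

lemma GDERIV_grad:
  fixes f :: "'a::euclidean_space \<Rightarrow> real"
  assumes "f differentiable at x"
  shows "GDERIV f x :> grad f x"
proof -
  obtain D where D: "(f has_derivative D) (at x)"
    using assms by (auto simp: differentiable_def)
  then have "linear D" by (rule has_derivative_linear)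
  then have "D = (\<lambda>h. h \<bullet> adjoint D 1)"
    by (auto simp: adjoint_works)
  then have "GDERIV f x :> adjoint D 1" using D by (simp add: gderiv_def)
  then show ?thesis unfolding grad_def using GDERIV_unique by (blast intro: theI)
qed

lemma grad_has_derivative_hessian:
  assumes "grad f differentiable at x"
  shows "(grad f has_derivative (\<lambda>h. hessian f x *v h)) (at x)"
proof -
  have D: "(grad f has_derivative frechet_derivative (grad f) (at x)) (at x)"
    using assms by (simp add: frechet_derivative_works)
  then show ?thesis
    unfolding hessian_def by (simp add: has_derivative_linear)
qed

lemma loewner_le_scaled_identity:
  assumes "loewner_le A (L *\<^sub>R mat 1)"
  shows "v \<bullet> (A *v v) \<le> L * (norm v)\<^sup>2"
proof -
  have "(L *\<^sub>R mat 1 - A) *v v = L *\<^sub>R v - A *v v"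
    by (simp add: matrix_vector_mult_diff_rdistrib scaleR_matrix_vector_assoc[symmetric])
  then show ?thesis
    using assms[unfolded loewner_le_def, rule_format, of v]
    by (simp add: inner_diff_right power2_norm_eq_inner)
qed

text \<open>Second-order Taylor expansion along the segment from \<open>x\<close> to
  \<open>y\<close>, with the Lagrange remainder bounded by the Loewner inequality.\<close>

lemma descent_lemma:
  fixes f :: "real ^ 'n \<Rightarrow> real"
  assumes f: "twice_continuously_differentiable f"
    and L: "\<And>x. loewner_le (hessian f x) (L *\<^sub>R mat 1)"
  shows "f y \<le> f x + (y - x) \<bullet> grad f x + L / 2 * (norm (y - x))\<^sup>2"
proof -
  define d where "d = y - x"
  \<comment> \<open>\<open>\<phi> m\<close> is the derivative of order \<open>m\<close> of
    \<open>f\<close> along the segment, for \<open>m = 0, 1, 2\<close>, in the form used by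
    Maclaurin's theorem.\<close>
  define \<phi> where "\<phi> = (\<lambda>(m::nat) t. if m = 0 then f (x + t *\<^sub>R d)
    else if m = 1 then d \<bullet> grad f (x + t *\<^sub>R d) else d \<bullet> (hessian f (x + t *\<^sub>R d) *v d))"
  have line: "((\<lambda>t. x + t *\<^sub>R d) has_derivative (\<lambda>h. h *\<^sub>R d)) (at t)" for t
    by (auto intro!: derivative_eq_intros)
  have "((\<lambda>t. f (x + t *\<^sub>R d)) has_derivative (\<lambda>h. (h *\<^sub>R d) \<bullet> grad f (x + t *\<^sub>R d))) (at t)" for t
    using f by (intro has_derivative_compose[OF line])
      (simp add: twice_continuously_differentiable_def GDERIV_grad gderiv_def[symmetric])
  then have d1: "DERIV (\<phi> 0) t :> \<phi> 1 t" for t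
    by (simp add: \<phi>_def has_field_derivative_def mult_commute_abs)
  have "((\<lambda>t. grad f (x + t *\<^sub>R d)) has_derivative (\<lambda>h. hessian f (x + t *\<^sub>R d) *v (h *\<^sub>R d))) (at t)" for t
    using f by (intro has_derivative_compose[OF line])
      (simp add: twice_continuously_differentiable_def grad_has_derivative_hessian)
  then have "((\<lambda>t. d \<bullet> grad f (x + t *\<^sub>R d)) has_derivative
      (\<lambda>h. d \<bullet> (hessian f (x + t *\<^sub>R d) *v (h *\<^sub>R d)))) (at t)" for t
    by (rule has_derivative_inner_right)
  then have d2: "DERIV (\<phi> 1) t :> \<phi> 2 t" for t
    by (simp add: \<phi>_def has_field_derivative_def matrix_vector_mult_scaleR mult_commute_abs)
  have "\<exists>t. 0 < t \<and> t \<le> 1 \<and> f (x + 1 *\<^sub>R d) = (\<Sum>m<2. \<phi> m 0 / fact m * 1 ^ m) + \<phi> 2 t / fact 2 * 1 ^ 2"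
  proof (rule Maclaurin2[where f = "\<lambda>t. f (x + t *\<^sub>R d)"])
    show "\<forall>m t. m < 2 \<and> 0 \<le> t \<and> t \<le> 1 \<longrightarrow> DERIV (\<phi> m) t :> \<phi> (Suc m) t"
      using d1 d2 by (auto simp: numeral_2_eq_2 less_Suc_eq)
  qed (simp_all add: \<phi>_def)
  then obtain t where "f y = f x + d \<bullet> grad f x + (d \<bullet> (hessian f (x + t *\<^sub>R d) *v d)) / 2"
    by (auto simp: \<phi>_def d_def lessThan_nat_numeral lessThan_Suc numeral_2_eq_2)
  then show ?thesis
    using loewner_le_scaled_identity[OF L, of d "x + t *\<^sub>R d"] by (simp add: d_def)
qed

section \<open>Bounds, optimal value and derivative of the envelope\<close>

lemma fb_envelope_real:
  fixes g :: "'a::euclidean_space \<Rightarrow> ereal"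
  assumes "proper_fun g" "closed_fun g" "convex_fun g" "0 < \<mu>"
  shows "fb_envelope \<mu> f g x = ereal (f x + real_of_ereal (moreau_envelope \<mu> g (x - \<mu> *\<^sub>R grad f x))
    - \<mu> / 2 * (norm (grad f x))\<^sup>2)"
  by (subst fb_envelope_def, subst moreau_envelope_real[OF assms, symmetric]) simp

text \<open>The Moreau envelope is tested at \<open>x\<close> itself: the penalty of the
  displacement \<open>\<mu> *\<^sub>R grad f x\<close> cancels the subtracted term of the
  envelope.\<close>

lemma fb_envelope_le:
  fixes g :: "'a::euclidean_space \<Rightarrow> ereal"
  assumes "proper_fun g" "closed_fun g" "convex_fun g" and \<mu>: "0 < \<mu>"
  shows "fb_envelope \<mu> f g x \<le> ereal (f x) + g x"
proof (cases "g x")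
  case (real r)
  let ?v = "x - \<mu> *\<^sub>R grad f x"
  have "1 / (2 * \<mu>) * (norm (x - ?v))\<^sup>2 = \<mu> / 2 * (norm (grad f x))\<^sup>2"
    using \<mu> by (simp add: power2_eq_square)
  then have "ereal (real_of_ereal (moreau_envelope \<mu> g ?v)) \<le> ereal (r + \<mu> / 2 * (norm (grad f x))\<^sup>2)"
    unfolding moreau_envelope_real[OF assms]
    using moreau_envelope_le[OF assms, of ?v x] unfolding real plus_ereal.simps(1) by (simp only:)
  then show ?thesis unfolding fb_envelope_real[OF assms] real by simp
qed (use assms in \<open>auto simp: proper_fun_def\<close>)

lemma le_fb_envelope:
  fixes f :: "real ^ 'n \<Rightarrow> real"
  assumes g: "proper_fun g" "closed_fun g" "convex_fun g" and \<mu>: "0 < \<mu>"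
    and f: "twice_continuously_differentiable f"
    and L: "\<And>x. loewner_le (hessian f x) (L *\<^sub>R mat 1)" and \<mu>L: "\<mu> * L \<le> 1"
    and p: "p = prox \<mu> g (x - \<mu> *\<^sub>R grad f x)"
  shows "ereal (f p) + g p \<le> fb_envelope \<mu> f g x"
proof -
  obtain r where r: "g p = ereal r" using prox_in_domain[OF g \<mu>] p by metis
  have "L \<le> 1 / \<mu>" using \<mu>L \<mu> by (simp add: field_simps)
  then have "L / 2 * (norm (p - x))\<^sup>2 \<le> 1 / (2 * \<mu>) * (norm (p - x))\<^sup>2"
    by (intro mult_right_mono) auto
  then have "f p \<le> f x + (p - x) \<bullet> grad f x + 1 / (2 * \<mu>) * (norm (p - x))\<^sup>2"
    using descent_lemma[OF f L, of p x] by linarith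
  \<comment> \<open>Completing the square turns the quadratic model of \<open>f\<close> at
    \<open>x\<close> into the proximal penalty around the forward step.\<close>
  also have "(norm (p - x))\<^sup>2 = (norm (p - (x - \<mu> *\<^sub>R grad f x)))\<^sup>2
      - 2 * \<mu> * ((p - x) \<bullet> grad f x) - \<mu>\<^sup>2 * (norm (grad f x))\<^sup>2"
    by (simp add: power2_norm_eq_inner algebra_simps inner_commute power2_eq_square[of \<mu>])
  also have "f x + (p - x) \<bullet> grad f x + 1 / (2 * \<mu>) * \<dots>
      = f x + 1 / (2 * \<mu>) * (norm (p - (x - \<mu> *\<^sub>R grad f x)))\<^sup>2 - \<mu> / 2 * (norm (grad f x))\<^sup>2"
    using \<mu> by (simp add: field_simps power2_eq_square)
  finally show ?thesis
    using r by (simp add: fb_envelope_def moreau_envelope_def p)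
qed

lemma optimal_value_fb_envelope:
  fixes f :: "real ^ 'n \<Rightarrow> real"
  assumes "proper_fun g" "closed_fun g" "convex_fun g" "0 < \<mu>"
    and "twice_continuously_differentiable f"
    and "\<And>x. loewner_le (hessian f x) (L *\<^sub>R mat 1)" "\<mu> * L \<le> 1"
  shows "optimal_value (fb_envelope \<mu> f g) = optimal_value (\<lambda>x. ereal (f x) + g x)"
  unfolding optimal_value_def
proof (rule antisym)
  show "(INF x. fb_envelope \<mu> f g x) \<le> (INF x. ereal (f x) + g x)"
    using fb_envelope_le[OF assms(1-4)] by (intro INF_mono) blast
  show "(INF x. ereal (f x) + g x) \<le> (INF x. fb_envelope \<mu> f g x)"
    using le_fb_envelope[OF assms refl] by (intro INF_mono) blast
qed

lemma fb_envelope_has_derivative: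
  fixes f :: "real ^ 'n \<Rightarrow> real"
  assumes g: "proper_fun g" "closed_fun g" "convex_fun g" and \<mu>: "0 < \<mu>"
    and f: "twice_continuously_differentiable f"
  shows "((\<lambda>x. real_of_ereal (fb_envelope \<mu> f g x)) has_derivative
    (\<lambda>h. (h - \<mu> *\<^sub>R (hessian f x *v h)) \<bullet> gen_grad_map \<mu> f g x)) (at x)"
proof -
  let ?v = "\<lambda>x. x - \<mu> *\<^sub>R grad f x"
  have f': "(f has_derivative (\<lambda>h. h \<bullet> grad f x)) (at x)"
    and H: "(grad f has_derivative (\<lambda>h. hessian f x *v h)) (at x)"
    using f GDERIV_grad[of f x] grad_has_derivative_hessian[of f x]
    by (auto simp: twice_continuously_differentiable_def gderiv_def)
  have v: "(?v has_derivative (\<lambda>h. h - \<mu> *\<^sub>R (hessian f x *v h))) (at x)"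
    by (intro derivative_intros H)
  have M: "((\<lambda>x. real_of_ereal (moreau_envelope \<mu> g (?v x))) has_derivative
      (\<lambda>h. (h - \<mu> *\<^sub>R (hessian f x *v h)) \<bullet> ((1 / \<mu>) *\<^sub>R (?v x - prox \<mu> g (?v x))))) (at x)"
    by (rule has_derivative_compose[OF v moreau_envelope_gderiv[OF g \<mu>, unfolded gderiv_def]])
  have N: "((\<lambda>x. \<mu> / 2 * (norm (grad f x))\<^sup>2) has_derivative
      (\<lambda>h. \<mu> * (grad f x \<bullet> (hessian f x *v h)))) (at x)"
    unfolding power2_norm_eq_inner
    by (rule derivative_eq_intros H refl)+ (simp add: fun_eq_iff inner_commute)
  \<comment> \<open>With the Moreau gradient written as \<open>G - grad f x\<close>, all terms in
    \<open>grad f x\<close> cancel. The Hessian stays applied to \<open>h\<close>, so it is never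
    transposed.\<close>
  have "(1 / \<mu>) *\<^sub>R (?v x - prox \<mu> g (?v x)) = gen_grad_map \<mu> f g x - grad f x"
    using \<mu> by (simp add: gen_grad_map_def algebra_simps)
  then have "(\<lambda>h. h \<bullet> grad f x + (h - \<mu> *\<^sub>R (hessian f x *v h)) \<bullet> ((1 / \<mu>) *\<^sub>R (?v x - prox \<mu> g (?v x)))
      - \<mu> * (grad f x \<bullet> (hessian f x *v h)))
    = (\<lambda>h. (h - \<mu> *\<^sub>R (hessian f x *v h)) \<bullet> gen_grad_map \<mu> f g x)"
    by (simp add: fun_eq_iff inner_diff_left inner_diff_right inner_commute)
  then show ?thesis
    using has_derivative_diff[OF has_derivative_add[OF f' M] N]
    unfolding fb_envelope_real[OF g \<mu>] by simp
qed

section \<open>Exponential convergence\<close>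

text \<open>Gronwall's argument: with the integrating factor \<open>exp (\<rho> * t)\<close> the
  product \<open>w\<close> has nonpositive derivative.\<close>

lemma exponential_decay:
  fixes u :: "real \<Rightarrow> real"
  assumes u: "\<And>t. 0 \<le> t \<Longrightarrow> (u has_real_derivative u' t) (at t within {0..})"
    and le: "\<And>t. 0 \<le> t \<Longrightarrow> u' t \<le> - \<rho> * u t" and "0 \<le> T"
  shows "u T \<le> exp (- \<rho> * T) * u 0"
proof -
  define w where "w = (\<lambda>t. exp (\<rho> * t) * u t)"
  have w: "(w has_real_derivative exp (\<rho> * t) * (u' t + \<rho> * u t)) (at t within {0..})" if "0 \<le> t" for t
    unfolding w_def by (rule derivative_eq_intros u that refl)+ (simp add: algebra_simps)
  have "w T \<le> w 0"
  \<comment> \<open>At 0 only a one-sided derivative is available; this rule asks for derivatives in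
    the open interval and continuity on the closed one.\<close>
  proof (rule DERIV_nonpos_imp_decreasing_open[OF \<open>0 \<le> T\<close>])
    fix t :: real assume "0 < t"
    then have "at t within {0..} = at t" by (intro at_within_interior) simp
    then have "(w has_real_derivative exp (\<rho> * t) * (u' t + \<rho> * u t)) (at t)"
      using w[of t] \<open>0 < t\<close> by simp
    moreover have "exp (\<rho> * t) * (u' t + \<rho> * u t) \<le> 0"
      using le[of t] \<open>0 < t\<close> by (simp add: mult_nonneg_nonpos)
    ultimately show "\<exists>y. (w has_real_derivative y) (at t) \<and> y \<le> 0" by blast
  next
    have "continuous_on {0..} w"
      unfolding continuous_on_eq_continuous_within using w by (auto intro: DERIV_continuous)
    then show "continuous_on {0..T} w" by (rule continuous_on_subset) auto
  qed
  then have "exp (- \<rho> * T) * w T \<le> exp (- \<rho> * T) * u 0" by (simp add: w_def)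
  moreover have "exp (- \<rho> * T) * w T = u T" by (simp add: w_def exp_minus)
  ultimately show ?thesis by (simp only:)
qed

lemma fb_envelope_flow_derivative:
  fixes f :: "real ^ 'n \<Rightarrow> real"
  assumes g: "proper_fun g" "closed_fun g" "convex_fun g" and \<mu>: "0 < \<mu>"
    and f: "twice_continuously_differentiable f"
    and L: "\<And>x. loewner_le (hessian f x) (L *\<^sub>R mat 1)"
    and sol: "prox_grad_flow_solution \<mu> f g x" and t: "0 \<le> t"
  obtains y where
    "((\<lambda>t. real_of_ereal (fb_envelope \<mu> f g (x t))) has_real_derivative y) (at t within {0..})"
    "y \<le> - (\<mu> * (1 - \<mu> * L)) * (norm (gen_grad_map \<mu> f g (x t)))\<^sup>2"
proof -
  define G where "G = gen_grad_map \<mu> f g (x t)"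
  \<comment> \<open>\<open>h\<close> is the velocity of the flow, the direction in which the
    envelope is differentiated.\<close>
  define h where "h = - (\<mu> *\<^sub>R G)"
  have "h = - (x t - prox \<mu> g (x t - \<mu> *\<^sub>R grad f (x t)))"
    using \<mu> by (simp add: h_def G_def gen_grad_map_def)
  then have "(x has_derivative (\<lambda>s. s *\<^sub>R h)) (at t within {0..})"
    using sol t by (simp add: prox_grad_flow_solution_def has_vector_derivative_def)
  from has_derivative_compose[OF this fb_envelope_has_derivative[OF g \<mu> f]]
  have "((\<lambda>t. real_of_ereal (fb_envelope \<mu> f g (x t))) has_real_derivative
      (h - \<mu> *\<^sub>R (hessian f (x t) *v h)) \<bullet> G) (at t within {0..})"
    unfolding has_field_derivative_def G_def[symmetric]
    by (rule has_derivative_eq_rhs)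
      (simp add: fun_eq_iff matrix_vector_mult_scaleR inner_diff_left algebra_simps)
  moreover have "(h - \<mu> *\<^sub>R (hessian f (x t) *v h)) \<bullet> G
      = - \<mu> * (norm G)\<^sup>2 + \<mu>\<^sup>2 * (G \<bullet> (hessian f (x t) *v G))"
    unfolding h_def
    by (simp add: matrix_vector_mult_scaleR linear_neg[OF matrix_vector_mul_linear] inner_diff_left
        inner_diff_right power2_norm_eq_inner[symmetric] inner_commute power2_eq_square[of \<mu>])
  moreover have "\<mu>\<^sup>2 * (G \<bullet> (hessian f (x t) *v G)) \<le> \<mu>\<^sup>2 * (L * (norm G)\<^sup>2)"
    by (intro mult_left_mono loewner_le_scaled_identity L) simp
  ultimately show ?thesis
    by (intro that) (auto simp: G_def algebra_simps power2_eq_square)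
qed

theorem theorem3:
  fixes f :: "real ^ 'n \<Rightarrow> real" and g :: "real ^ 'n \<Rightarrow> ereal"
    and L\<^sub>f \<mu> \<gamma> :: real
  assumes "proper_fun g" and "closed_fun g" and "convex_fun g"
    and "convex_on UNIV f" and "twice_continuously_differentiable f"
    and "\<And>x. loewner_le (hessian f x) (L\<^sub>f *\<^sub>R mat 1)"
    and "0 < \<mu>" and "\<mu> < 1 / L\<^sub>f" and "\<gamma> > 0"
    and "proximal_PL \<gamma> \<mu> f g"
  shows "optimal_value (fb_envelope \<mu> f g) = optimal_value (\<lambda>x. ereal (f x) + g x) \<and>
    (\<forall>x. prox_grad_flow_solution \<mu> f g x \<longrightarrow>
      (\<forall>t\<ge>0. fb_envelope \<mu> f g (x t) - optimal_value (fb_envelope \<mu> f g)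
        \<le> ereal (exp (- (\<gamma> * \<mu> * (1 - \<mu> * L\<^sub>f)) * t))
           * (fb_envelope \<mu> f g (x 0) - optimal_value (fb_envelope \<mu> f g))))"
proof (intro conjI allI impI)
  note g = assms(1-3) and \<mu> = \<open>0 < \<mu>\<close> and f = assms(5) and L = assms(6) and PL = assms(10)
  \<comment> \<open>This rules out \<open>L\<^sub>f \<le> 0\<close> (in particular
    \<open>1 / 0 = 0\<close>), so \<open>\<mu> < 1 / L\<^sub>f\<close> can be multiplied
    out.\<close>
  have "0 < 1 / L\<^sub>f" using assms(7,8) by linarith
  then have \<mu>L: "\<mu> * L\<^sub>f < 1" using assms(8) by (simp add: field_simps)
  then show "optimal_value (fb_envelope \<mu> f g) = optimal_value (\<lambda>x. ereal (f x) + g x)"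
    by (intro optimal_value_fb_envelope[OF g \<mu> f L]) simp
  define F where "F = (\<lambda>x. real_of_ereal (fb_envelope \<mu> f g x))"
  have F: "fb_envelope \<mu> f g x = ereal (F x)" for x
    by (simp add: F_def fb_envelope_real[OF g \<mu>])
  have "optimal_value (fb_envelope \<mu> f g) \<le> ereal (F 0)"
    unfolding optimal_value_def F[symmetric] by (rule INF_lower) simp
  \<comment> \<open>An infimum of \<open>-\<infinity>\<close> would make the right-hand side of the
    PL inequality infinite, while the left-hand side is real. Hence the optimal value is a real
    \<open>m\<close>.\<close>
  moreover have "optimal_value (fb_envelope \<mu> f g) \<noteq> -\<infinity>"
    using PL \<open>\<gamma> > 0\<close> by (auto simp: proximal_PL_def F)
  ultimately obtain m where m: "optimal_value (fb_envelope \<mu> f g) = ereal m"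
    by (cases "optimal_value (fb_envelope \<mu> f g)") auto
  have PL': "\<gamma> * (F x - m) \<le> (norm (gen_grad_map \<mu> f g x))\<^sup>2" for x
    using PL by (simp add: proximal_PL_def F m)
  fix x :: "real \<Rightarrow> real ^ 'n" and t :: real
  assume sol: "prox_grad_flow_solution \<mu> f g x" and t: "0 \<le> t"
  have "\<exists>y. ((\<lambda>t. F (x t) - m) has_real_derivative y) (at s within {0..})
      \<and> y \<le> - (\<gamma> * \<mu> * (1 - \<mu> * L\<^sub>f)) * (F (x s) - m)" if s: "0 \<le> s" for s
  proof -
    obtain y where y: "((\<lambda>t. F (x t)) has_real_derivative y) (at s within {0..})"
      "y \<le> - (\<mu> * (1 - \<mu> * L\<^sub>f)) * (norm (gen_grad_map \<mu> f g (x s)))\<^sup>2"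
      using fb_envelope_flow_derivative[OF g \<mu> f L sol s] unfolding F_def by blast
    \<comment> \<open>The PL inequality is scaled by the nonnegative factor
      \<open>\<mu> * (1 - \<mu> * L\<^sub>f)\<close>, which produces the rate.\<close>
    have "\<mu> * (1 - \<mu> * L\<^sub>f) * (\<gamma> * (F (x s) - m))
        \<le> \<mu> * (1 - \<mu> * L\<^sub>f) * (norm (gen_grad_map \<mu> f g (x s)))\<^sup>2"
      using \<mu> \<mu>L by (intro mult_left_mono PL') simp
    then have "y \<le> - (\<gamma> * \<mu> * (1 - \<mu> * L\<^sub>f)) * (F (x s) - m)"
      using y(2) by (simp add: mult_ac)
    moreover have "((\<lambda>t. F (x t) - m) has_real_derivative y) (at s within {0..})"
      using DERIV_diff[OF y(1) DERIV_const[of m]] by simp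
    ultimately show ?thesis by blast
  qed
  then obtain u' where
    "\<And>s. 0 \<le> s \<Longrightarrow> ((\<lambda>t. F (x t) - m) has_real_derivative u' s) (at s within {0..})"
    "\<And>s. 0 \<le> s \<Longrightarrow> u' s \<le> - (\<gamma> * \<mu> * (1 - \<mu> * L\<^sub>f)) * (F (x s) - m)"
    by metis
  from exponential_decay[OF this t]
  show "fb_envelope \<mu> f g (x t) - optimal_value (fb_envelope \<mu> f g)
      \<le> ereal (exp (- (\<gamma> * \<mu> * (1 - \<mu> * L\<^sub>f)) * t))
         * (fb_envelope \<mu> f g (x 0) - optimal_value (fb_envelope \<mu> f g))"
    by (simp add: F m)
qed

end
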